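(* Let $N=2$, $K=2$, let $\alpha,p_1,p_2,\beta\in(0,1)$, $\beta_1=\beta_2=\beta$, and let $a_1,a_2\ge 0$ with $a_1+a_2=1$. Let $\rho_i$ and $\rho_i^*$ be the particle densities (stationary probabilities of occupancy) of cell $i$ in the system $S$ with these parameters and in the associated one-type system $S^*$, respectively. Then $\rho_i=\rho_i^*$ for $i=1,2$.
   Context: System $S$ (synchronous exclusion process with two particle types on an open lattice of two cells). The cells are $1$ and $2$, each containing at most one particle, and each particle is of type $1$ or $2$. A state is $(x_1,x_2)\in\{0,1,2\}^2$, where $x_i=0$ means cell $i$ is vacant and $x_i=k>0$ means cell $i$ contains a particle of type $k$. Time is discrete. Given the state at time $t$, all of the following random events are mutually independent, occur simultaneously, depend only on the configuration at time $t$, and determine the state at time $t+1$ (a finite Markov chain): (i) if cell $1$ is vacant at time $t$, then with probability $\alpha$ a particle arrives from outside and is in cell $1$ at time $t+1$; it is of type $k$ with probability $a_k$; (ii) if at time $t$ cell $1$ contains a particle of type $k$ and cell $2$ is vacant, then with probability $p_k$ this particle is in cell $2$ at time $t+1$ (and cell $1$ is then vacant), otherwise it stays; (iii) if at time $t$ cell $2$ contains a particle of type $k$, then with probability $\beta_k$ it leaves the system and cell $2$ is vacant at time $t+1$, otherwise it stays. A particle in cell $1$ stays there if cell $2$ is occupied at time $t$. System $S^*$: the same process with the same $N=2$ and $\alpha$, but with a single type of particles, whose movement probability (from cell $1$ to a vacant cell $2$) is $p^*=\left(\frac{a_1}{p_1}+\frac{a_2}{p_2}\right)^{-1}$ and whose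 exit probability from cell $2$ is $\beta^*=\left(\frac{a_1}{\beta_1}+\frac{a_2}{\beta_2}\right)^{-1}$ (which equals $\beta$ when $\beta_1=\beta_2=\beta$). Its states are $(x_1^*,x_2^* )\in\{0,1\}^2$ with $x_i^*=0$ if cell $i$ is vacant and $x_i^*=1$ if it is occupied. The stationary probability of a state is the limit of the probability that the system is in this state as $t\to\infty$ (it exists and is independent of the initial state; equivalently, it is given by the unique stationary distribution of the Markov chain). The density $\rho_i$ (resp. $\rho_i^*$) is the probability, under the stationary distribution of $S$ (resp. $S^*$), that cell $i$ is occupied. *)

theory Defs
  imports "HOL-Probability.Probability"
begin

text \<open>
  A state is a pair (cell 1, cell 2), where \<open>None\<close> is a vacant cell and \<open>Some k\<close> a cell
  occupied by a particle of type \<open>k\<close>. The type \<open>'k\<close> of particle types is left open, so that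
  the one-type system is the same process with \<open>'k = unit\<close>; its states \<open>None\<close> and \<open>Some ()\<close>
  of a cell are then the values 0 and 1.
\<close>

type_synonym 'k state = "'k option \<times> 'k option"

definition arrival :: "real \<Rightarrow> 'k pmf \<Rightarrow> 'k option pmf" where
  "arrival \<alpha> A =
     bind_pmf (bernoulli_pmf \<alpha>) (\<lambda>arrives. if arrives then map_pmf Some A else return_pmf None)"

fun exit_cell2 :: "('k \<Rightarrow> real) \<Rightarrow> 'k option \<Rightarrow> 'k option pmf" where
  "exit_cell2 \<beta> None = return_pmf None"
| "exit_cell2 \<beta> (Some k) =
     map_pmf (\<lambda>leaves. if leaves then None else Some k) (bernoulli_pmf (\<beta> k))"

text \<open>
  One synchronous step. Every event is decided by the old configuration only: a cell vacated in
  this step is not refilled in the same step. The \<open>pair_pmf\<close> expresses the independence of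
  the events at the two cells. In \<open>(Some k, None)\<close> neither an arrival nor an exit is possible.
\<close>

fun step :: "real \<Rightarrow> 'k pmf \<Rightarrow> ('k \<Rightarrow> real) \<Rightarrow> ('k \<Rightarrow> real) \<Rightarrow> 'k state \<Rightarrow> 'k state pmf" where
  "step \<alpha> A p \<beta> (None, y) = pair_pmf (arrival \<alpha> A) (exit_cell2 \<beta> y)"
| "step \<alpha> A p \<beta> (Some k, None) =
     map_pmf (\<lambda>moves. if moves then (None, Some k) else (Some k, None)) (bernoulli_pmf (p k))"
| "step \<alpha> A p \<beta> (Some k, Some l) = pair_pmf (return_pmf (Some k)) (exit_cell2 \<beta> (Some l))"

definition distribution_at :: "('s \<Rightarrow> 's pmf) \<Rightarrow> 's \<Rightarrow> nat \<Rightarrow> 's pmf" where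
  "distribution_at K s0 t = ((\<lambda>\<mu>. bind_pmf \<mu> K) ^^ t) (return_pmf s0)"

text \<open>
  The stationary probability of a state is its limiting probability, which must not depend on
  the initial state.
\<close>

definition stationary_distribution :: "('s \<Rightarrow> 's pmf) \<Rightarrow> 's pmf" where
  "stationary_distribution K =
     (THE \<pi>. \<forall>s0 s. (\<lambda>t. pmf (distribution_at K s0 t) s) \<longlonglongrightarrow> pmf \<pi> s)"

fun cell :: "nat \<Rightarrow> 'k state \<Rightarrow> 'k option" where
  "cell i (x, y) = (if i = 1 then x else y)"

definition cell_density :: "('k state \<Rightarrow> 'k state pmf) \<Rightarrow> nat \<Rightarrow> real" where
  "cell_density K i = measure_pmf.prob (stationary_distribution K) {s. cell i s \<noteq> None}"

datatype ptype = T1 | T2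

text \<open>
  \<open>embed_pmf a\<close> is the distribution with weights \<open>a\<close>, which is meaningful if these are
  nonnegative and sum to 1.
\<close>

definition system_S ::
    "real \<Rightarrow> (ptype \<Rightarrow> real) \<Rightarrow> (ptype \<Rightarrow> real) \<Rightarrow> (ptype \<Rightarrow> real) \<Rightarrow> ptype state \<Rightarrow> ptype state pmf" where
  "system_S \<alpha> a p \<beta> = step \<alpha> (embed_pmf a) p \<beta>"

definition weighted_harmonic :: "(ptype \<Rightarrow> real) \<Rightarrow> (ptype \<Rightarrow> real) \<Rightarrow> real" where
  "weighted_harmonic a q = inverse (a T1 / q T1 + a T2 / q T2)"

definition system_S_star ::
    "real \<Rightarrow> (ptype \<Rightarrow> real) \<Rightarrow> (ptype \<Rightarrow> real) \<Rightarrow> (ptype \<Rightarrow> real) \<Rightarrow> unit state \<Rightarrow> unit state pmf" where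
  "system_S_star \<alpha> a p \<beta> =
     step \<alpha> (return_pmf ()) (\<lambda>_. weighted_harmonic a p) (\<lambda>_. weighted_harmonic a \<beta>)"

end

theory Submission
  imports Defs
begin

text \<open>
  Write \<open>w\<^sub>k\<close> for the arrival type distribution and \<open>\<gamma> = \<alpha> + \<beta> - \<alpha>\<beta>\<close>. When all types have the
  same exit probability \<open>\<beta>\<close>, the balance equations are solved, up to normalisation, by the weights
  \<open>\<beta>(1-\<alpha>)/\<alpha>\<close> for the empty state, \<open>w\<^sub>l\<close> for a particle of type \<open>l\<close> in cell 2 only, \<open>\<gamma> w\<^sub>k / p\<^sub>k\<close> for
  a particle of type \<open>k\<close> in cell 1 only, and \<open>\<alpha>(1-\<beta>)/\<beta> w\<^sub>k w\<^sub>l\<close> for the full states. Summed over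
  types, they depend on the \<open>w\<^sub>k\<close> and \<open>p\<^sub>k\<close> only through \<open>\<Sum>\<^sub>k w\<^sub>k / p\<^sub>k\<close>, which is the same for the
  one-type system. That the limit of the chain is this stationary distribution follows from
  Doeblin's condition: every state reaches the empty state in exactly three steps with positive
  probability.
\<close>

section \<open>Convergence of finite chains under Doeblin's condition\<close>

lemma distribution_at_Suc: "distribution_at K x (Suc t) = bind_pmf (distribution_at K x t) K"
  by (simp add: distribution_at_def)

lemma distribution_at_add:
  "distribution_at K x (n + t) = bind_pmf (distribution_at K x n) (\<lambda>y. distribution_at K y t)"
proof (induction t)
  case 0
  then show ?case by (simp add: distribution_at_def bind_return_pmf')
next
  case (Suc t)
  then show ?case
    by (simp only: add_Suc_right distribution_at_Suc bind_assoc_pmf)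
qed

lemma bind_distribution_at_stationary:
  assumes "bind_pmf \<pi> K = \<pi>"
  shows "bind_pmf \<pi> (\<lambda>x. distribution_at K x t) = \<pi>"
proof (induction t)
  case 0
  then show ?case by (simp add: distribution_at_def bind_return_pmf')
next
  case (Suc t)
  then show ?case
    using assms by (simp add: distribution_at_Suc flip: bind_assoc_pmf)
qed

lemma pmf_bind_finite:
  fixes M :: "'s::finite pmf"
  shows "pmf (bind_pmf M f) y = (\<Sum>x\<in>UNIV. pmf M x * pmf (f x) y)"
  by (simp add: pmf_bind integral_measure_pmf_real[of UNIV] mult.commute)

lemma sum_pmf_UNIV: "(\<Sum>x\<in>UNIV. pmf M x) = 1" for M :: "'s::finite pmf"
  by (simp add: sum_pmf_eq_1)

text \<open>Going back by \<open>n\<close> steps makes the probability of \<open>s\<close> at time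
  \<open>t\<close> an average of its values at time \<open>t - n\<close>. All these averages put
  mass at least \<epsilon> on the same value, the one for \<open>s0\<close>, so they differ only in
  the remaining mass 1 - \<epsilon>, and the spread over starting states shrinks by this
  factor.\<close>

lemma doeblin_contraction:
  fixes K :: "'s::finite \<Rightarrow> 's pmf"
  assumes "n > 0" and "0 \<le> \<epsilon>" and \<epsilon>: "\<And>x. \<epsilon> \<le> pmf (distribution_at K x n) s0"
  shows "\<exists>c. \<forall>x. pmf (distribution_at K x t) s \<in> {c .. c + (1 - \<epsilon>) ^ (t div n)}"
proof (induction t rule: less_induct)
  case (less t)
  show ?case
  proof (cases "t < n")
    case True
    \<comment> \<open>Here \<open>t div n = 0\<close>, so the interval is [0, 1].\<close>
    then show ?thesis by (intro exI[of _ 0]) (simp add: pmf_le_1)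
  next
    case False
    define g where "g y = pmf (distribution_at K y (t - n)) s" for y
    define d where "d = (1 - \<epsilon>) ^ ((t - n) div n)"
    obtain c where c: "\<And>y. c \<le> g y" "\<And>y. g y \<le> c + d"
      using less[of "t - n"] False \<open>n > 0\<close> by (auto simp: g_def d_def)
    have width: "(1 - \<epsilon>) ^ (t div n) = (1 - \<epsilon>) * d"
      using False \<open>n > 0\<close> by (simp add: d_def le_div_geq)
    have "pmf (distribution_at K x t) s \<in> {\<epsilon> * g s0 + (1 - \<epsilon>) * c .. \<epsilon> * g s0 + (1 - \<epsilon>) * c + (1 - \<epsilon>) * d}" for x
    proof -
      define q where "q = pmf (distribution_at K x n)"
      have E: "pmf (distribution_at K x t) s = (\<Sum>y\<in>UNIV. q y * g y)"
        using False distribution_at_add[of K x n "t - n"] by (simp add: pmf_bind_finite q_def g_def)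
      \<comment> \<open>Applied to \<open>g - c\<close> this bounds the average from below, applied
        to \<open>c + d - g\<close> from above.\<close>
      have lower: "\<epsilon> * h s0 \<le> (\<Sum>y\<in>UNIV. q y * h y)" if "\<And>y. 0 \<le> h y" for h :: "'s \<Rightarrow> real"
      proof -
        have "\<epsilon> * h s0 \<le> q s0 * h s0"
          using \<epsilon>[of x] that by (simp add: q_def mult_right_mono)
        also have "\<dots> \<le> (\<Sum>y\<in>UNIV. q y * h y)"
          using that by (intro member_le_sum) (auto simp: q_def)
        finally show ?thesis .
      qed
      have q1: "(\<Sum>y\<in>UNIV. q y) = 1" by (simp add: q_def sum_pmf_UNIV)
      have "(\<Sum>y\<in>UNIV. q y * (g y - c)) = (\<Sum>y\<in>UNIV. q y * g y) - c"
        using q1 by (simp add: right_diff_distrib sum_subtractf flip: sum_distrib_right)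
      moreover have "(\<Sum>y\<in>UNIV. q y * (c + d - g y)) = c + d - (\<Sum>y\<in>UNIV. q y * g y)"
        using q1 by (simp add: right_diff_distrib sum_subtractf flip: sum_distrib_right)
      ultimately show ?thesis
        using lower[of "\<lambda>y. g y - c"] lower[of "\<lambda>y. c + d - g y"] c E
        by (simp add: algebra_simps)
    qed
    then show ?thesis unfolding width by blast
  qed
qed

text \<open>By stationarity, \<open>pmf \<pi> s\<close> is the \<pi>-average over starting states of
  the probability of \<open>s\<close> at time \<open>t\<close>. It thus lies in the same shrinking
  interval as each of these probabilities.\<close>

lemma stationary_distribution_eqI:
  fixes K :: "'s::finite \<Rightarrow> 's pmf"
  assumes "n > 0" and s0: "\<And>x. s0 \<in> set_pmf (distribution_at K x n)"
    and \<pi>: "bind_pmf \<pi> K = \<pi>"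
  shows "stationary_distribution K = \<pi>"
  unfolding stationary_distribution_def
proof (rule the_equality)
  \<comment> \<open>Finiteness of the state space makes the positive lower bound uniform in the
    starting state.\<close>
  define \<epsilon> where "\<epsilon> = Min (range (\<lambda>x. pmf (distribution_at K x n) s0))"
  have \<epsilon>: "\<epsilon> \<le> pmf (distribution_at K x n) s0" for x
    by (simp add: \<epsilon>_def)
  have "\<epsilon> > 0"
    using s0 by (simp add: \<epsilon>_def pmf_positive)
  have "\<epsilon> \<le> 1"
    using order_trans[OF \<epsilon>[of s0] pmf_le_1] .
  have lim: "(\<lambda>t. pmf (distribution_at K x t) s) \<longlonglongrightarrow> pmf \<pi> s" for x s
  proof -
    have bound: "\<bar>pmf (distribution_at K x t) s - pmf \<pi> s\<bar> \<le> (1 - \<epsilon>) ^ (t div n)" for t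
    proof -
      define P where "P y = pmf (distribution_at K y t) s" for y
      obtain c where c: "\<And>y. c \<le> P y" "\<And>y. P y \<le> c + (1 - \<epsilon>) ^ (t div n)"
        using doeblin_contraction[OF \<open>n > 0\<close> less_imp_le[OF \<open>\<epsilon> > 0\<close>] \<epsilon>, of t s]
        by (auto simp: P_def)
      have avg: "pmf \<pi> s = (\<Sum>y\<in>UNIV. pmf \<pi> y * P y)"
        by (subst bind_distribution_at_stationary[OF \<pi>, of t, symmetric])
          (simp add: pmf_bind_finite P_def)
      have "(\<Sum>y\<in>UNIV. pmf \<pi> y * c) \<le> pmf \<pi> s"
        unfolding avg by (intro sum_mono mult_left_mono c) auto
      moreover have "pmf \<pi> s \<le> (\<Sum>y\<in>UNIV. pmf \<pi> y * (c + (1 - \<epsilon>) ^ (t div n)))"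
        unfolding avg by (intro sum_mono mult_left_mono c) auto
      ultimately show ?thesis
        using c[of x] by (simp add: P_def sum_pmf_UNIV flip: sum_distrib_right)
    qed
    have "(\<lambda>t. (1 - \<epsilon>) ^ (t div n)) \<longlonglongrightarrow> 0"
      using \<open>\<epsilon> > 0\<close> \<open>\<epsilon> \<le> 1\<close> \<open>n > 0\<close>
      by (intro filterlim_compose[OF LIMSEQ_realpow_zero filterlim_at_top_div_const_nat]) auto
    then have "(\<lambda>t. pmf (distribution_at K x t) s - pmf \<pi> s) \<longlonglongrightarrow> 0"
      by (rule Lim_null_comparison[rotated]) (simp add: bound)
    then show ?thesis by (rule LIM_zero_cancel)
  qed
  then show "\<forall>x s. (\<lambda>t. pmf (distribution_at K x t) s) \<longlonglongrightarrow> pmf \<pi> s" by blast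
  fix \<pi>' assume "\<forall>x s. (\<lambda>t. pmf (distribution_at K x t) s) \<longlonglongrightarrow> pmf \<pi>' s"
  then show "\<pi>' = \<pi>"
    using lim by (intro pmf_eqI) (blast intro: LIMSEQ_unique)
qed

section \<open>Sums over states and one-step transition probabilities\<close>

lemma sum_option_UNIV:
  "(\<Sum>x\<in>UNIV. f x) = f None + (\<Sum>k\<in>UNIV. f (Some k))" for f :: "'k::finite option \<Rightarrow> real"
  by (simp add: UNIV_option_conv sum.reindex)

lemma sum_state_UNIV:
  fixes f :: "'k::finite state \<Rightarrow> real"
  shows "(\<Sum>s\<in>UNIV. f s) = (\<Sum>x\<in>UNIV. \<Sum>y\<in>UNIV. f (x, y))"
  by (simp add: sum.cartesian_product UNIV_Times_UNIV[symmetric] del: UNIV_Times_UNIV)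

lemma pmf_arrival:
  assumes "\<alpha> \<in> {0..1}"
  shows "pmf (arrival \<alpha> A) None = 1 - \<alpha>" and "pmf (arrival \<alpha> A) (Some k) = \<alpha> * pmf A k"
  using assms by (auto simp: arrival_def pmf_bind pmf_map_inj' pmf_eq_0_set_pmf)

lemma pmf_exit_cell2:
  assumes "\<beta> l \<in> {0..1}"
  shows "pmf (exit_cell2 \<beta> (Some l)) None = \<beta> l"
    and "pmf (exit_cell2 \<beta> (Some l)) (Some k) = (if k = l then 1 - \<beta> l else 0)"
  using assms by (auto simp: map_pmf_def pmf_bind)

lemma pmf_step_move:
  assumes "p k \<in> {0..1}"
  shows "pmf (step \<alpha> A p \<beta> (Some k, None)) s =
    (if s = (None, Some k) then p k else if s = (Some k, None) then 1 - p k else 0)"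
  using assms by (auto simp: map_pmf_def pmf_bind)

section \<open>Stationary distribution and densities for a common exit probability\<close>

locale homogeneous_exit =
  fixes \<alpha> \<beta> :: real and A :: "'k::finite pmf" and p :: "'k \<Rightarrow> real"
  assumes \<alpha>: "0 < \<alpha>" "\<alpha> < 1" and \<beta>: "0 < \<beta>" "\<beta> < 1"
    and p: "\<And>k. 0 < p k" "\<And>k. p k < 1"
begin

abbreviation K where "K \<equiv> step \<alpha> A p (\<lambda>_. \<beta>)"

text \<open>The mean number of attempts that an arriving particle needs to move into a vacant cell
  2.\<close>

definition H :: real where "H = (\<Sum>k\<in>UNIV. pmf A k / p k)"

text \<open>Scaled so that the states with only cell 2 occupied have total weight 1. The balance
  equations at the empty state, at \<open>(None, Some l)\<close> and at
  \<open>(Some k, Some l)\<close> then yield the other three formulas.\<close>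

fun weight :: "'k state \<Rightarrow> real" where
  "weight (None, None) = \<beta> * (1 - \<alpha>) / \<alpha>"
| "weight (None, Some l) = pmf A l"
| "weight (Some k, None) = (\<alpha> + \<beta> - \<alpha> * \<beta>) * pmf A k / p k"
| "weight (Some k, Some l) = \<alpha> * (1 - \<beta>) / \<beta> * pmf A k * pmf A l"

definition Z :: real where
  "Z = \<beta> * (1 - \<alpha>) / \<alpha> + 1 + (\<alpha> + \<beta> - \<alpha> * \<beta>) * H + \<alpha> * (1 - \<beta>) / \<beta>"

definition stat :: "'k state pmf" where "stat = embed_pmf (\<lambda>s. weight s / Z)"

text \<open>The quantity is 1 - (1 - \<alpha>) (1 - \<beta>), the probability of leaving a state
  \<open>(None, Some l)\<close> in one step.\<close>

lemma rate_pos: "0 < \<alpha> + \<beta> - \<alpha> * \<beta>"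
  using mult_strict_mono[of "1 - \<alpha>" 1 "1 - \<beta>" 1] \<alpha> \<beta> by (simp add: algebra_simps)

lemma weight_nonneg: "0 \<le> weight s"
  using \<alpha> \<beta> p[THEN less_imp_le] rate_pos by (induction s rule: weight.induct) auto

lemma sum_weight_single:
  "(\<Sum>l\<in>UNIV. weight (None, Some l)) = 1"
  "(\<Sum>k\<in>UNIV. weight (Some k, None)) = (\<alpha> + \<beta> - \<alpha> * \<beta>) * H"
  by (simp_all add: sum_pmf_UNIV H_def sum_distrib_left)

lemma sum_weight_full:
  "(\<Sum>k\<in>UNIV. \<Sum>l\<in>UNIV. weight (Some k, Some l)) = \<alpha> * (1 - \<beta>) / \<beta>"
proof -
  have "(\<Sum>k\<in>UNIV. \<Sum>l\<in>UNIV. c * pmf A k * pmf A l) = c" for c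
    by (simp add: sum_pmf_UNIV flip: sum_distrib_left)
  then show ?thesis unfolding weight.simps .
qed

lemma sum_weight: "(\<Sum>s\<in>UNIV. weight s) = Z"
  using sum_weight_single sum_weight_full
  by (simp add: sum_state_UNIV sum_option_UNIV sum.distrib Z_def del: weight.simps(2-4))

lemma Z_pos: "0 < Z"
proof -
  have "0 \<le> H" using p[THEN less_imp_le] by (auto simp: H_def intro!: sum_nonneg)
  then have "0 \<le> (\<alpha> + \<beta> - \<alpha> * \<beta>) * H" using rate_pos by simp
  then show ?thesis using \<alpha> \<beta> by (simp add: Z_def add_pos_nonneg add_nonneg_pos)
qed

lemma pmf_stat: "pmf stat s = weight s / Z"
  unfolding stat_def
proof (rule pmf_embed_pmf)
  show "0 \<le> weight s / Z" for s
    using weight_nonneg Z_pos by (simp add: less_imp_le)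
  have "(\<Sum>s\<in>UNIV. weight s / Z) = 1"
    using Z_pos by (simp add: sum_weight flip: sum_divide_distrib)
  then show "(\<integral>\<^sup>+ s. ennreal (weight s / Z) \<partial>count_space UNIV) = 1"
    using weight_nonneg Z_pos by (simp add: nn_integral_count_space_finite sum_ennreal less_imp_le)
qed

text \<open>Each right-hand side collects the predecessors of one state. Since \<beta> is common to
  all types, the type of an exiting particle enters only through a sum over \<open>l\<close>.
  Leaving \<open>u\<close> arbitrary separates the transitions from the algebra of the
  weights.\<close>

lemma expected_inflow:
  fixes u :: "'k state \<Rightarrow> real"
  shows "(\<Sum>s\<in>UNIV. u s * pmf (K s) (None, None)) =
      (1 - \<alpha>) * (u (None, None) + \<beta> * (\<Sum>l\<in>UNIV. u (None, Some l)))" (is ?vacant)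
    and "(\<Sum>s\<in>UNIV. u s * pmf (K s) (None, Some l)) =
      (1 - \<alpha>) * (1 - \<beta>) * u (None, Some l) + p l * u (Some l, None)" (is ?second)
    and "(\<Sum>s\<in>UNIV. u s * pmf (K s) (Some k, None)) =
      \<alpha> * pmf A k * (u (None, None) + \<beta> * (\<Sum>l\<in>UNIV. u (None, Some l)))
      + (1 - p k) * u (Some k, None) + \<beta> * (\<Sum>l\<in>UNIV. u (Some k, Some l))" (is ?first)
    and "(\<Sum>s\<in>UNIV. u s * pmf (K s) (Some k, Some l)) =
      (1 - \<beta>) * (\<alpha> * pmf A k * u (None, Some l) + u (Some k, Some l))" (is ?full)
proof -
  have a: "\<alpha> \<in> {0..1}" and b: "\<beta> \<in> {0..1}" using \<alpha> \<beta> by auto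
  have p': "p k \<in> {0..1}" for k using p[of k] by (simp add: less_imp_le)
  \<comment> \<open>Point masses become \<open>of_bool\<close> factors; \<open>assoc\<close> moves
    them to the front and \<open>select\<close> collapses the sum.\<close>
  have select: "(\<Sum>i\<in>UNIV. of_bool (i = k) * f i) = f k" for k and f :: "'k \<Rightarrow> real"
    by (simp add: of_bool_def if_distrib[of "\<lambda>x. x * _"] cong: if_cong)
  have assoc: "x * (of_bool P * y) = of_bool P * (x * y)" for x y :: real and P
    by simp
  note simps = sum_state_UNIV sum_option_UNIV pmf_arrival[OF a]
    pmf_exit_cell2[of "\<lambda>_. \<beta>", OF b] pmf_step_move[of p, OF p'] pmf_pair pmf_return
    if_distrib[of "times _"] indicator_def
  \<comment> \<open>Left folded, these terms are evaluated by \<open>pmf_step_move\<close> and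
    \<open>pmf_exit_cell2\<close>.\<close>
  note dels = step.simps(2) exit_cell2.simps(2)
  show ?vacant
    by (simp add: simps sum_distrib_left algebra_simps del: dels cong: if_cong)
  show ?second
    by (simp add: simps algebra_simps del: dels cong: if_cong)
  show ?first
    by (simp add: simps sum.distrib sum_distrib_left del: dels cong: if_cong,
        simp add: assoc select flip: sum_distrib_left,
        simp add: algebra_simps sum_distrib_left)
  show ?full
    by (simp add: simps sum.distrib del: dels cong: if_cong,
        simp add: assoc select,
        simp add: algebra_simps)
qed

lemma weight_balance: "(\<Sum>s'\<in>UNIV. weight s' * pmf (K s') s) = weight s"
proof (induction s rule: weight.induct)
  case 1
  show ?case unfolding expected_inflow sum_weight_single using \<alpha> by (simp add: field_simps)
next
  case (2 l)
  show ?case unfolding expected_inflow using p[of l] by (simp add: field_simps)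
next
  case (3 k)
  have full: "(\<Sum>l\<in>UNIV. weight (Some k, Some l)) = \<alpha> * (1 - \<beta>) / \<beta> * pmf A k"
    by (simp only: weight.simps sum_pmf_UNIV mult_1_right flip: sum_distrib_left)
  show ?case unfolding expected_inflow sum_weight_single full
    using \<alpha> \<beta> p[of k] by (simp add: field_simps)
next
  case (4 k l)
  show ?case unfolding expected_inflow using \<beta> by (simp add: field_simps)
qed

lemma stat_stationary: "bind_pmf stat K = stat"
proof (rule pmf_eqI)
  fix s
  have "pmf (bind_pmf stat K) s = (\<Sum>s'\<in>UNIV. weight s' * pmf (K s') s) / Z"
    by (simp add: pmf_bind_finite pmf_stat sum_divide_distrib)
  then show "pmf (bind_pmf stat K) s = pmf stat s"
    by (simp add: weight_balance pmf_stat)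
qed

text \<open>From a full state the route is exit, move, exit without arrival. Other states need fewer
  steps and wait in the empty state, which has a self-loop because \<alpha> < 1.\<close>

lemma vacant_reachable: "(None, None) \<in> set_pmf (distribution_at K s 3)"
proof -
  have stay: "(None, None) \<in> set_pmf (K (None, y))" for y
    using \<alpha> \<beta> by (cases y) (auto simp: arrival_def)
  have move: "(None, Some k) \<in> set_pmf (K (Some k, None))" for k
    using p[of k] by auto
  have exit: "(Some k, None) \<in> set_pmf (K (Some k, Some l))" for k l
    using \<beta> by auto
  have K3: "distribution_at K s 3 = bind_pmf (bind_pmf (K s) K) K"
    by (simp add: eval_nat_numeral distribution_at_def bind_return_pmf)
  show ?thesis unfolding K3 set_bind_pmf
    using stay move exit by (induction s rule: weight.induct) blast+
qed

lemma stationary_distribution_step: "stationary_distribution K = stat"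
  by (rule stationary_distribution_eqI[OF _ vacant_reachable stat_stationary]) simp

lemma cell_density_step:
  "cell_density K i =
    (if i = 1 then (\<alpha> + \<beta> - \<alpha> * \<beta>) * H + \<alpha> * (1 - \<beta>) / \<beta> else 1 + \<alpha> * (1 - \<beta>) / \<beta>) / Z"
proof -
  have "cell_density K i = (\<Sum>s\<in>UNIV. if cell i s \<noteq> None then weight s / Z else 0)"
    unfolding cell_density_def stationary_distribution_step
    by (simp add: measure_measure_pmf_finite pmf_stat sum.If_cases)
  also have "\<dots> = (\<Sum>s\<in>UNIV. if cell i s \<noteq> None then weight s else 0) / Z"
    by (simp add: sum_divide_distrib if_distrib[of "\<lambda>x. x / Z"] cong: if_cong)
  finally show ?thesis
    using sum_weight_single sum_weight_full
    by (simp add: sum_state_UNIV sum_option_UNIV sum.distrib del: weight.simps)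
qed

end

section \<open>Comparison of the two-type and one-type systems\<close>

lemma UNIV_ptype: "UNIV = {T1, T2}"
  using ptype.exhaust by auto

instance ptype :: finite
  by standard (simp add: UNIV_ptype)

lemma sum_ptype_UNIV: "(\<Sum>k\<in>UNIV. f k) = f T1 + f T2" for f :: "ptype \<Rightarrow> real"
  by (simp add: UNIV_ptype)

lemma pmf_embed_ptype:
  assumes "a T1 \<ge> 0" and "a T2 \<ge> 0" and "a T1 + a T2 = 1"
  shows "pmf (embed_pmf a) k = a k"
proof (rule pmf_embed_pmf)
  show nonneg: "0 \<le> a k" for k using assms by (cases k) auto
  show "(\<integral>\<^sup>+ k. ennreal (a k) \<partial>count_space UNIV) = 1"
    using assms nonneg by (simp add: nn_integral_count_space_finite sum_ennreal sum_ptype_UNIV)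
qed

theorem theorem4:
  fixes \<alpha> \<beta> :: real and a p b :: "ptype \<Rightarrow> real" and i :: nat
  assumes "\<alpha> \<in> {0<..<1}" and "p T1 \<in> {0<..<1}" and "p T2 \<in> {0<..<1}" and "\<beta> \<in> {0<..<1}"
    and "b T1 = \<beta>" and "b T2 = \<beta>"
    and "a T1 \<ge> 0" and "a T2 \<ge> 0" and "a T1 + a T2 = 1"
    and "i \<in> {1, 2}"
  shows "cell_density (system_S \<alpha> a p b) i = cell_density (system_S_star \<alpha> a p b) i"
proof -
  define h where "h = a T1 / p T1 + a T2 / p T2"
  have p: "0 < p k \<and> p k < 1" for k using assms by (cases k) auto
  have b: "b = (\<lambda>_. \<beta>)"
  proof
    show "b k = \<beta>" for k using assms by (cases k) auto
  qed
  \<comment> \<open>Some \<open>a k\<close> is positive, so the strict inequality holds for at least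
    one type. The resulting \<open>1 < h\<close> puts the movement probability \<open>1 / h\<close>
    of the one-type system strictly between 0 and 1, as the locale demands.\<close>
  have "a T1 / p T1 \<ge> a T1" "a T2 / p T2 \<ge> a T2"
    "a T1 > 0 \<Longrightarrow> a T1 / p T1 > a T1" "a T2 > 0 \<Longrightarrow> a T2 / p T2 > a T2"
    using p[of T1] p[of T2] assms by (simp_all add: field_simps mult_left_le)
  then have h: "1 < h" using assms unfolding h_def by linarith
  have b_star: "weighted_harmonic a b = \<beta>"
    using assms(9) by (simp add: weighted_harmonic_def b inverse_eq_divide flip: add_divide_distrib)
  have p_star: "weighted_harmonic a p = 1 / h"
    by (simp add: weighted_harmonic_def h_def inverse_eq_divide)
  interpret S: homogeneous_exit \<alpha> \<beta> "embed_pmf a" p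
    using assms p by unfold_locales auto
  interpret S': homogeneous_exit \<alpha> \<beta> "return_pmf ()" "\<lambda>_. 1 / h"
    using assms h by unfold_locales auto
  have "S.H = h"
    using assms by (simp add: S.H_def h_def sum_ptype_UNIV pmf_embed_ptype)
  \<comment> \<open>With a single type, \<open>H\<close> is the reciprocal of its movement
    probability.\<close>
  moreover have "S'.H = h"
    by (simp add: S'.H_def)
  ultimately show ?thesis
    unfolding system_S_def system_S_star_def b_star p_star
    by (simp add: b S.cell_density_step S'.cell_density_step S.Z_def S'.Z_def)
qed

end
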